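(* Let $m$ and $n$ be positive integers, let $a,b,c\in\mathbb{C}$, none of which equals zero or a negative integer, and put $s=c-a-b$. Let $$S_n(a,b;c)=\sum_{k=0}^{n-1}\frac{(a)_k(b)_k}{(c)_k\,k!},\qquad \omega_n=\frac{\Gamma(n+a)\Gamma(n+b)}{\Gamma(n)\Gamma(n+c)},\qquad \lambda_n=\frac{\Gamma(n+a)\Gamma(n+b)}{\Gamma(n)\Gamma(n+a+b)}.$$ (i) If $s=m$, then $$S_n(a,b;c)=\lambda_n\,\frac{\Gamma(c)\Gamma(c-a-b)}{\Gamma(c-a)\Gamma(c-b)}\sum_{k=0}^{m-1}\frac{(a)_k(b)_k}{(n+a+b)_k\,k!}.$$ (ii) If $s=-m$ and neither $a$ nor $b$ belongs to $\{1,2,\ldots,m\}$, then $$S_n(a,b;c)=\frac{\omega_n\Gamma(c)}{m\,\Gamma(a)\Gamma(b)}\sum_{k=0}^{m-1}\frac{(c-a)_k(c-b)_k}{(n+c)_k(1-m)_k}+\frac{(-1)^m}{m!}\,\frac{\lambda_n\Gamma(c)}{\Gamma(c-a)\Gamma(c-b)}\sum_{k=0}^\infty\frac{(a)_k(b)_k}{(n+a+b)_k\,k!}\,\bigl\{\psi(n+a+b+k)+\psi(1+k)-\psi(a+k)-\psi(b+k)\bigr\}.$$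
   Context: $\Gamma$ is the gamma function and $\psi(x)=\Gamma'(x)/\Gamma(x)$ is its logarithmic derivative. $(a)_k=\Gamma(a+k)/\Gamma(a)=a(a+1)\cdots(a+k-1)$ is the Pochhammer symbol, with $(a)_0=1$. In (i), in the degenerate case where $n+a+b$ is zero or a negative integer, the quantity $\lambda_n/(n+a+b)_k$ is read as $\Gamma(n+a)\Gamma(n+b)/\bigl(\Gamma(n)\Gamma(n+a+b+k)\bigr)$, with $1/\Gamma$ taken as the entire function vanishing at $0,-1,-2,\ldots$. *)

theory Defs
  imports "HOL-Analysis.Analysis"
begin

text \<open>
  The library's \<^const>\<open>Gamma\<close> is the inverse of the entire function \<^const>\<open>rGamma\<close>,
  with value \<open>0\<close> at the poles; so \<open>x / Gamma z\<close> is always \<open>x * rGamma z\<close>.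
  The rising factorial \<open>(a)\<^sub>k\<close> is \<^const>\<open>pochhammer\<close>, and
  \<open>\<psi> = \<Gamma>' / \<Gamma>\<close> is the library's \<^const>\<open>Digamma\<close>:
\<close>

lemma Digamma_eq_deriv_Gamma:
  fixes z :: complex
  assumes "z \<notin> \<int>\<^sub>\<le>\<^sub>0"
  shows "Digamma z = deriv Gamma z / Gamma z"
proof -
  have "deriv Gamma z = Gamma z * Digamma z"
    using assms by (intro DERIV_imp_deriv has_field_derivative_Gamma)
  then show ?thesis
    using assms by (simp add: Gamma_eq_zero_iff)
qed

definition hyp_partial_sum :: "nat \<Rightarrow> complex \<Rightarrow> complex \<Rightarrow> complex \<Rightarrow> complex" where
  "hyp_partial_sum n a b c =
     (\<Sum>k<n. pochhammer a k * pochhammer b k / (pochhammer c k * fact k))"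

definition omega :: "nat \<Rightarrow> complex \<Rightarrow> complex \<Rightarrow> complex \<Rightarrow> complex" where
  "omega n a b c =
     Gamma (of_nat n + a) * Gamma (of_nat n + b) / (Gamma (of_nat n) * Gamma (of_nat n + c))"

definition lam :: "nat \<Rightarrow> complex \<Rightarrow> complex \<Rightarrow> complex" where
  "lam n a b =
     Gamma (of_nat n + a) * Gamma (of_nat n + b) / (Gamma (of_nat n) * Gamma (of_nat n + a + b))"

text \<open>
  The quantity \<open>\<lambda>\<^sub>n / (n+a+b)\<^sub>k\<close>. If \<open>n+a+b\<close> is zero or a negative integer, the literal
  quotient has the form \<open>0 / 0\<close> for large \<open>k\<close>, and the first branch gives the intended reading.
\<close>

definition lam_quot :: "nat \<Rightarrow> complex \<Rightarrow> complex \<Rightarrow> nat \<Rightarrow> complex" where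
  "lam_quot n a b k =
     (if of_nat n + a + b \<in> \<int>\<^sub>\<le>\<^sub>0
      then Gamma (of_nat n + a) * Gamma (of_nat n + b) / Gamma (of_nat n)
             * rGamma (of_nat n + a + b + of_nat k)
      else lam n a b / pochhammer (of_nat n + a + b) k)"

end

theory Submission
  imports Defs
begin

text \<open>
  Both formulas are proved by induction on \<open>n\<close>, starting from \<open>n = 0\<close>, where both sides are \<open>0\<close> because
  \<open>1/\<Gamma>(0) = 0\<close>. Put
  \<open>\<Lambda>(n,x) = \<Gamma>(n+a) \<Gamma>(n+b) / (\<Gamma>(n) \<Gamma>(n+a+b+x))\<close>, which is \<open>\<lambda>\<^sub>n / (n+a+b)\<^sub>k\<close> for \<open>x = k\<close>, and
  \<open>C(n,x) = \<Gamma>(n+a) \<Gamma>(n+b) / (\<Gamma>(n+1) \<Gamma>(n+a+b+x))\<close>. The functional equation of \<open>\<Gamma>\<close> gives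
  \<open>\<Lambda>(n+1,x) - \<Lambda>(n,x) = (a+x)(b+x) C(n,x+1) - x C(n,x)\<close> (\<open>lam_ext_diff\<close>). Times a weight
  \<open>v(x)\<close> with \<open>(a+x)(b+x) v(x) = (x+1) v(x+1)\<close>, the right-hand side telescopes in \<open>x\<close>. Moreover, the
  increment \<open>(a)\<^sub>n (b)\<^sub>n / ((c)\<^sub>n n!)\<close> of the partial sum is \<open>\<Gamma>(c) / (\<Gamma>(a) \<Gamma>(b))\<close> times
  \<open>C(n,c-a-b)\<close> (\<open>hyp_partial_sum_Suc\<close>).

  For \<open>c-a-b = m\<close>, take \<open>x = k\<close> and \<open>v(k) = (a)\<^sub>k (b)\<^sub>k / k!\<close>; the sum over \<open>k < m\<close> telescopes to its upper
  boundary term, a multiple of \<open>C(n,m)\<close> (\<open>hyp_partial_sum_excess_pos\<close>).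

  For \<open>c-a-b = -m\<close>, the finite sum is the case \<open>x = k-m\<close>. Its boundary terms are a multiple of \<open>C(n,-m)\<close>, which
  is the required increment, and a multiple of \<open>C(n,0)\<close> (\<open>finite_part_diff\<close>). The terms of the
  digamma series are, up to a constant, the derivatives of \<open>v(x) \<Lambda>(n,x)\<close> at \<open>x = k\<close> with
  \<open>v(x) = \<Gamma>(a+x) \<Gamma>(b+x) / \<Gamma>(1+x)\<close>, so that this series telescopes too, the
  boundary term at infinity vanishes, and what remains is again a multiple of \<open>C(n,0)\<close>, cancelling the first
  (\<open>log_part_sums\<close>). Instead of differentiating, the proof verifies the differentiated identity at integers
  from the recurrence of \<open>\<psi>\<close>. Convergence and the limit at infinity use that the digamma combination and
  \<open>(a)\<^sub>k (b)\<^sub>k / ((n+a+b)\<^sub>k k!)\<close> are both \<open>O(1/k)\<close>.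
\<close>

section \<open>Growth of digamma differences and of Pochhammer quotients\<close>

lemma not_nonpos_Int_add_of_nat:
  fixes z :: complex
  assumes "z \<notin> \<int>\<^sub>\<le>\<^sub>0"
  shows "z + of_nat k \<notin> \<int>\<^sub>\<le>\<^sub>0" "z + of_nat k \<noteq> 0"
proof -
  show "z + of_nat k \<notin> \<int>\<^sub>\<le>\<^sub>0"
    using assms nonpos_Ints_diff_Nats[of "z + of_nat k" "of_nat k"] by auto
  then show "z + of_nat k \<noteq> 0" by auto
qed

lemma of_nat_over_shift_tendsto: "(\<lambda>j. of_nat j / (z + of_nat j) :: complex) \<longlonglongrightarrow> 1"
proof -
  have "(\<lambda>j. 1 / (z * inverse (of_nat j) + 1)) \<longlonglongrightarrow> 1 / (z * 0 + 1)"
    by (intro tendsto_intros lim_inverse_n) simp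
  then have "(\<lambda>j. 1 / (z * inverse (of_nat j) + 1)) \<longlonglongrightarrow> 1" by simp
  moreover have "\<forall>\<^sub>F j in sequentially. 1 / (z * inverse (of_nat j) + 1) = of_nat j / (z + of_nat j)"
    using eventually_gt_at_top[of "0::nat"]
    by eventually_elim (simp add: field_simps)
  ultimately show ?thesis by (rule Lim_transform_eventually)
qed

lemma Digamma_shift_diff_tendsto_0:
  fixes z w :: complex
  assumes z: "z \<notin> \<int>\<^sub>\<le>\<^sub>0" and w: "w \<notin> \<int>\<^sub>\<le>\<^sub>0"
  shows "(\<lambda>k. Digamma (z + of_nat k) - Digamma (w + of_nat k)) \<longlonglongrightarrow> 0"
proof -
  have sum_form: "Digamma (u + of_nat k) = Digamma u + (\<Sum>j<k. inverse (u + of_nat j))"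
    if u: "u \<notin> \<int>\<^sub>\<le>\<^sub>0" for u :: complex and k
  proof (induction k)
    case (Suc k)
    have "u + of_nat (Suc k) = (u + of_nat k) + 1" by simp
    then have "Digamma (u + of_nat (Suc k)) = Digamma (u + of_nat k) + 1 / (u + of_nat k)"
      using Digamma_plus1[OF not_nonpos_Int_add_of_nat(2)[OF u]] by presburger
    then show ?case by (simp add: Suc.IH inverse_eq_divide)
  qed simp
  have lim: "(\<lambda>k. Digamma (u + of_nat k) - of_real (ln (real k))) \<longlonglongrightarrow> 0"
    if u: "u \<notin> \<int>\<^sub>\<le>\<^sub>0" for u :: complex
  proof -
    have "(\<lambda>k. of_real (ln (real k)) - (\<Sum>j<k. inverse (u + of_nat j))) \<longlonglongrightarrow> Digamma u"
      using Digamma_LIMSEQ[of u] u by auto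
    from tendsto_diff[OF tendsto_const[of "Digamma u"] this] show ?thesis
      by (simp add: sum_form[OF u] algebra_simps)
  qed
  show ?thesis
    using tendsto_diff[OF lim[OF z] lim[OF w]] by simp
qed

text \<open>
  The difference \<open>D\<^sub>k = \<psi>(z+k) - \<psi>(w+k)\<close> is \<open>O(1/k)\<close>: it tends to \<open>0\<close>, and its increments are
  \<open>(w-z)/((z+k)(w+k))\<close>, hence at most \<open>M/(k(k+1)) = M/k - M/(k+1)\<close> in absolute value, so that
  the tail sum is at most \<open>M/k\<close>.
\<close>
lemma Digamma_shift_diff_Bseq:
  fixes z w :: complex
  assumes z: "z \<notin> \<int>\<^sub>\<le>\<^sub>0" and w: "w \<notin> \<int>\<^sub>\<le>\<^sub>0"
  shows "Bseq (\<lambda>k. of_nat k * (Digamma (z + of_nat k) - Digamma (w + of_nat k)))"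
proof -
  define D where "D k = Digamma (z + of_nat k) - Digamma (w + of_nat k)" for k
  have D_Suc: "D (Suc k) - D k = (w - z) / ((z + of_nat k) * (w + of_nat k))" for k
  proof -
    note nz = not_nonpos_Int_add_of_nat(2)[OF z, of k] not_nonpos_Int_add_of_nat(2)[OF w, of k]
    have eqs: "z + of_nat (Suc k) = (z + of_nat k) + 1" "w + of_nat (Suc k) = (w + of_nat k) + 1"
      by simp_all
    have "D (Suc k) - D k = 1 / (z + of_nat k) - 1 / (w + of_nat k)"
      unfolding D_def eqs Digamma_plus1[OF nz(1)] Digamma_plus1[OF nz(2)] by simp
    also have "\<dots> = (w - z) / ((z + of_nat k) * (w + of_nat k))"
      using nz by (simp add: field_simps)
    finally show ?thesis .
  qed
  have "(\<lambda>k. of_nat (Suc k) / ((w - 1) + of_nat (Suc k))) \<longlonglongrightarrow> 1"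
    by (rule LIMSEQ_Suc[OF of_nat_over_shift_tendsto])
  then have "(\<lambda>k. (w - z) * (of_nat k / (z + of_nat k)) * (of_nat (Suc k) / (w + of_nat k)))
               \<longlonglongrightarrow> (w - z) * 1 * 1"
    by (intro tendsto_mult tendsto_const of_nat_over_shift_tendsto) (simp add: algebra_simps)
  then have "Bseq (\<lambda>k. (w - z) * (of_nat k / (z + of_nat k)) * (of_nat (Suc k) / (w + of_nat k)))"
    using Bseq_eq_bounded convergentI convergent_imp_Bseq by blast
  then obtain M where M: "M > 0"
    "\<And>k. norm ((w - z) * (of_nat k / (z + of_nat k)) * (of_nat (Suc k) / (w + of_nat k))) \<le> M"
    by (auto elim: BseqE)
  have step: "norm (D (Suc k) - D k) \<le> M / real k - M / real (Suc k)" if "k > 0" for k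
  proof -
    have "(w - z) * (of_nat k / (z + of_nat k)) * (of_nat (Suc k) / (w + of_nat k))
            = (D (Suc k) - D k) * of_nat (k * Suc k)"
      by (simp add: D_Suc field_simps)
    then have "norm (D (Suc k) - D k) * real (k * Suc k) \<le> M"
      using M(2)[of k] by (simp only: norm_mult norm_of_nat)
    then have "norm (D (Suc k) - D k) \<le> M / real (k * Suc k)"
      using that by (subst pos_le_divide_eq) (simp_all del: of_nat_mult)
    also have "\<dots> = M / real k - M / real (Suc k)"
      using that by (simp add: field_simps)
    finally show ?thesis .
  qed
  have tail: "norm (D (k + i) - D k) \<le> M / real k - M / real (k + i)" if k: "k > 0" for k i
  proof (induction i)
    case (Suc i)
    have "norm (D (k + Suc i) - D k) \<le> norm (D (Suc (k + i)) - D (k + i)) + norm (D (k + i) - D k)"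
      using norm_triangle_ineq[of "D (Suc (k + i)) - D (k + i)" "D (k + i) - D k"] by simp
    then show ?case using Suc.IH step[of "k + i"] k by simp
  qed simp
  have "norm (of_nat k * D k) \<le> M" for k
  proof (cases "k = 0")
    case False
    have "(\<lambda>i. norm (D (i + k) - D k)) \<longlonglongrightarrow> norm (0 - D k)"
      using Digamma_shift_diff_tendsto_0[OF z w]
      by (intro tendsto_intros LIMSEQ_ignore_initial_segment) (simp add: D_def)
    moreover have "norm (D (i + k) - D k) \<le> M / real k" for i
    proof -
      have "0 \<le> M / real (k + i)" using M(1) by simp
      with tail[of k i] False show ?thesis by (simp add: add.commute)
    qed
    ultimately have "norm (0 - D k) \<le> M / real k"
      by (intro LIMSEQ_le_const2[where a = "M / real k"]) auto
    then show ?thesis using False by (simp add: norm_mult field_simps)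
  qed (use M(1) in simp)
  then show ?thesis unfolding D_def by (rule BseqI')
qed

text \<open>
  The quotient below is at most of order \<open>k\<^sup>-\<^sup>n\<^sup>-\<^sup>1\<close>, because Euler's limit formula for \<open>1/\<Gamma>\<close> gives
  \<open>(z)\<^sub>k\<^sub>+\<^sub>1 \<sim> k! k\<^sup>z / \<Gamma>(z)\<close>. Only the bound \<open>O(1/k)\<close>, valid for every \<open>n \<ge> 0\<close>, is needed.
\<close>
lemma pochhammer_quotient_Bseq:
  fixes a b :: complex
  assumes N: "of_nat n + a + b \<notin> \<int>\<^sub>\<le>\<^sub>0"
  shows "Bseq (\<lambda>k. of_nat k * (pochhammer a k * pochhammer b k
                                 / (pochhammer (of_nat n + a + b) k * fact k)))"
proof -
  let ?N = "of_nat n + a + b"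
  define r where "r k = of_nat k * (pochhammer a k * pochhammer b k
                                      / (pochhammer ?N k * fact k))" for k
  define q where "q k = rGamma_series a k * rGamma_series b k / rGamma_series ?N k" for k
  \<comment> \<open>Up to the factor \<open>k\<^sup>n\<close> the exponentials in the three Euler products cancel.\<close>
  have r_eq: "r (Suc k) = q k / of_nat k ^ n" if "k > 0" for k
  proof -
    have pow: "exp (of_nat n * of_real (ln (real k))) = (of_nat k ^ n :: complex)"
      using that by (simp add: exp_of_nat_mult exp_of_real)
    have exps: "exp (?N * of_real (ln (real k)))
            = exp (a * of_real (ln (real k))) * exp (b * of_real (ln (real k))) * of_nat k ^ n"
      by (simp only: pow[symmetric] exp_add[symmetric] distrib_right add_ac)
    have "pochhammer ?N (Suc k) \<noteq> 0" using N pochhammer_eq_0_imp_nonpos_Int by blast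
    moreover have "of_nat (Suc k) \<noteq> (0::complex)" by (simp del: of_nat_Suc)
    ultimately show ?thesis using that
      unfolding r_def q_def rGamma_series_def fact_Suc exps
      by (simp add: divide_simps del: of_nat_Suc)
  qed
  have "q \<longlonglongrightarrow> rGamma a * rGamma b / rGamma ?N"
    unfolding q_def using N by (intro tendsto_intros) (simp add: rGamma_eq_zero_iff)
  then have "Bseq q" by (intro convergent_imp_Bseq convergentI)
  then obtain M where M: "M > 0" "\<And>k. norm (q k) \<le> M" by (auto elim: BseqE)
  have "norm (r (Suc k)) \<le> norm (r 1) + M" for k
  proof (cases "k = 0")
    case False
    then have "norm (r (Suc k)) = norm (q k) / real k ^ n"
      by (simp add: r_eq norm_divide norm_power)
    also have "\<dots> \<le> norm (q k) / 1"
      using False by (intro divide_left_mono) auto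
    finally show ?thesis using M(2)[of k] norm_ge_zero[of "r 1"] by linarith
  qed (use M(1) in simp)
  then have "Bseq (\<lambda>k. r (Suc k))" by (rule BseqI')
  then show ?thesis
    unfolding r_def by (rule Bseq_Suc_iff[THEN iffD1])
qed

section \<open>The telescoping pair\<close>

text \<open>
  The quotient \<open>\<lambda>\<^sub>n / (n+a+b)\<^sub>x\<close> for an arbitrary complex \<open>x\<close>. Writing it with the entire function
  \<^const>\<open>rGamma\<close> covers the degenerate values of \<open>n+a+b\<close>, and makes it vanish for \<open>n = 0\<close>.
\<close>
definition lam_ext :: "nat \<Rightarrow> complex \<Rightarrow> complex \<Rightarrow> complex \<Rightarrow> complex" where
  "lam_ext n a b x = Gamma (of_nat n + a) * Gamma (of_nat n + b) * rGamma (of_nat n)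
                       * rGamma (of_nat n + a + b + x)"

text \<open>The companion of \<^const>\<open>lam_ext\<close>: the factor \<open>1/\<Gamma>(n)\<close> is replaced by \<open>1/\<Gamma>(n+1)\<close>.\<close>
definition cert :: "nat \<Rightarrow> complex \<Rightarrow> complex \<Rightarrow> complex \<Rightarrow> complex" where
  "cert n a b x = Gamma (of_nat n + a) * Gamma (of_nat n + b) * rGamma (of_nat n + 1)
                    * rGamma (of_nat n + a + b + x)"

lemma lam_ext_0 [simp]: "lam_ext 0 a b x = 0"
  by (simp add: lam_ext_def)

lemma cert_plus1: "cert n a b x = (of_nat n + a + b + x) * cert n a b (x + 1)"
proof -
  have "of_nat n + a + b + (x + 1) = (of_nat n + a + b + x) + 1" by simp
  then show ?thesis
    unfolding cert_def rGamma_plus1[of "of_nat n + a + b + x", symmetric] by (simp only: mult_ac)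
qed

lemma lam_ext_eq_cert: "lam_ext n a b x = of_nat n * cert n a b x"
  unfolding lam_ext_def cert_def rGamma_plus1[of "of_nat n", symmetric] by simp

lemma lam_ext_Suc:
  assumes "a \<notin> \<int>\<^sub>\<le>\<^sub>0" "b \<notin> \<int>\<^sub>\<le>\<^sub>0"
  shows "lam_ext (Suc n) a b x = (of_nat n + a) * (of_nat n + b) * cert n a b (x + 1)"
proof -
  have Gamma_Suc: "Gamma (of_nat (Suc n) + u) = (of_nat n + u) * Gamma (of_nat n + u)"
    if "u \<notin> \<int>\<^sub>\<le>\<^sub>0" for u :: complex
    using Gamma_plus1[OF not_nonpos_Int_add_of_nat(1)[OF that, of n]] by (simp add: add_ac)
  have "of_nat (Suc n) + a + b + x = of_nat n + a + b + (x + 1)"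
       "of_nat (Suc n) = (of_nat n + 1 :: complex)" by simp_all
  then show ?thesis
    unfolding lam_ext_def cert_def Gamma_Suc[OF assms(1)] Gamma_Suc[OF assms(2)] by (simp only: mult_ac)
qed

text \<open>
  The identity on which everything rests: multiplied by a weight \<open>v(x)\<close> with
  \<open>(a+x)(b+x) v(x) = (x+1) v(x+1)\<close>, the right-hand side is the increment of
  \<open>x v(x) cert(x)\<close> from \<open>x\<close> to \<open>x+1\<close>.
\<close>
lemma lam_ext_diff:
  assumes "a \<notin> \<int>\<^sub>\<le>\<^sub>0" "b \<notin> \<int>\<^sub>\<le>\<^sub>0"
  shows "lam_ext (Suc n) a b x - lam_ext n a b x
           = (a + x) * (b + x) * cert n a b (x + 1) - x * cert n a b x"
  unfolding lam_ext_Suc[OF assms] lam_ext_eq_cert[of n] cert_plus1[of n a b x] by algebra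

text \<open>The next term of the hypergeometric series is itself a value of \<^const>\<open>cert\<close>.\<close>
lemma hyp_partial_sum_Suc:
  assumes "a \<notin> \<int>\<^sub>\<le>\<^sub>0" "b \<notin> \<int>\<^sub>\<le>\<^sub>0" "c \<notin> \<int>\<^sub>\<le>\<^sub>0"
  shows "hyp_partial_sum (Suc n) a b c
           = hyp_partial_sum n a b c + Gamma c / (Gamma a * Gamma b) * cert n a b (c - a - b)"
proof -
  have "rGamma (of_nat n + 1 :: complex) = inverse (fact n)"
    by (simp add: rGamma_inverse_Gamma Gamma_fact add.commute)
  moreover have "of_nat n + a + b + (c - a - b) = c + of_nat n" by simp
  ultimately have "pochhammer a n * pochhammer b n / (pochhammer c n * fact n)
          = Gamma c / (Gamma a * Gamma b) * cert n a b (c - a - b)"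
    using assms by (simp add: cert_def pochhammer_Gamma rGamma_inverse_Gamma field_simps)
  then show ?thesis by (simp add: hyp_partial_sum_def)
qed

section \<open>Positive integer parametric excess\<close>

lemma hyp_partial_sum_excess_pos:
  assumes a: "a \<notin> \<int>\<^sub>\<le>\<^sub>0" and b: "b \<notin> \<int>\<^sub>\<le>\<^sub>0" and c: "c \<notin> \<int>\<^sub>\<le>\<^sub>0"
    and m: "m > 0" and s: "c = a + b + of_nat m"
  shows "hyp_partial_sum n a b c =
           Gamma c * Gamma (of_nat m) / (Gamma (c - a) * Gamma (c - b))
             * (\<Sum>k<m. lam_ext n a b (of_nat k) * (pochhammer a k * pochhammer b k / fact k))"
proof (induction n)
  case (Suc n)
  let ?K = "Gamma c * Gamma (of_nat m) / (Gamma (c - a) * Gamma (c - b))"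
  define v where "v k = pochhammer a k * pochhammer b k / fact k" for k
  define G where "G k = of_nat k * v k * cert n a b (of_nat k)" for k
  have v_Suc: "of_nat (Suc k) * v (Suc k) = (a + of_nat k) * (b + of_nat k) * v k" for k
  proof -
    have "of_nat (Suc k) \<noteq> (0::complex)" by (simp del: of_nat_Suc)
    then show ?thesis unfolding v_def fact_Suc pochhammer_Suc
      by (simp add: divide_simps del: of_nat_Suc)
  qed
  have "lam_ext (Suc n) a b (of_nat k) * v k - lam_ext n a b (of_nat k) * v k = G (Suc k) - G k" for k
  proof -
    have "lam_ext (Suc n) a b (of_nat k) * v k - lam_ext n a b (of_nat k) * v k
            = ((a + of_nat k) * (b + of_nat k) * v k) * cert n a b (of_nat k + 1)
                - of_nat k * v k * cert n a b (of_nat k)"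
      unfolding left_diff_distrib[symmetric] lam_ext_diff[OF a b] by algebra
    also have "\<dots> = G (Suc k) - G k"
      unfolding v_Suc[symmetric] G_def by (simp add: add.commute)
    finally show ?thesis .
  qed
  then have "(\<Sum>k<m. lam_ext (Suc n) a b (of_nat k) * v k) - (\<Sum>k<m. lam_ext n a b (of_nat k) * v k)
               = G m"
    using sum_lessThan_telescope[of G m] by (simp add: G_def flip: sum_subtractf)
  moreover have "?K * G m = Gamma c / (Gamma a * Gamma b) * cert n a b (c - a - b)"
  proof -
    have "Gamma (of_nat m + 1 :: complex) = of_nat m * Gamma (of_nat m)"
      using m by (intro Gamma_plus1) (simp add: of_nat_in_nonpos_Ints_iff)
    then have "fact m = of_nat m * Gamma (of_nat m :: complex)"
      using Gamma_fact[of m, where 'a = complex] by (simp add: add.commute)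
    moreover have "c - a = b + of_nat m" "c - b = a + of_nat m" "c - a - b = of_nat m"
      using s by simp_all
    moreover have "Gamma a \<noteq> 0" "Gamma b \<noteq> 0" "Gamma (a + of_nat m) \<noteq> 0" "Gamma (b + of_nat m) \<noteq> 0"
      "Gamma (of_nat m :: complex) \<noteq> 0"
      using a b m not_nonpos_Int_add_of_nat(1)
      by (simp_all add: Gamma_eq_zero_iff of_nat_in_nonpos_Ints_iff)
    ultimately show ?thesis
      using m a b unfolding G_def v_def by (simp add: pochhammer_Gamma field_simps)
  qed
  ultimately show ?case
    unfolding hyp_partial_sum_Suc[OF a b c] Suc.IH v_def
    by (metis (no_types, lifting) diff_add_cancel distrib_left add.commute)
qed (simp add: hyp_partial_sum_def)

section \<open>Negative integer parametric excess: the finite sum\<close>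

text \<open>
  Here the identity is used at \<open>x = k - m\<close>. Telescoping leaves two boundary terms: the one at
  \<open>x = -m\<close> produces the next term of the hypergeometric series, and the one at \<open>x = 0\<close> is
  compensated by the infinite series.
\<close>
lemma finite_part_diff:
  fixes a b :: complex and m n :: nat
  defines "T \<equiv> \<lambda>n. \<Sum>k<m. lam_ext n a b (of_nat k - of_nat m)
            * (pochhammer (a - of_nat m) k * pochhammer (b - of_nat m) k / pochhammer (1 - of_nat m) k)"
  assumes a: "a \<notin> \<int>\<^sub>\<le>\<^sub>0" and b: "b \<notin> \<int>\<^sub>\<le>\<^sub>0" and m: "m > 0"
  shows "T (Suc n) - T n = of_nat m * (cert n a b (- of_nat m)
           - (-1) ^ m / fact m * (pochhammer (a - of_nat m) m * pochhammer (b - of_nat m) m)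
               * cert n a b 0)"
proof -
  define P where "P k = pochhammer (a - of_nat m) k * pochhammer (b - of_nat m) k" for k
  define v where "v k = P k / pochhammer (1 - of_nat m) k" for k
  \<comment> \<open>For \<open>k < m\<close> this is \<open>(k-m) v\<^sub>k cert(k-m)\<close>. Writing it with \<open>(-m)\<^sub>k\<close> in place of \<open>(1-m)\<^sub>k\<close>
    keeps it meaningful at \<open>k = m\<close>, where \<open>(1-m)\<^sub>m = 0\<close>.\<close>
  define G where
    "G k = - of_nat m * (P k / pochhammer (- of_nat m) k) * cert n a b (of_nat k - of_nat m)" for k
  have step: "lam_ext (Suc n) a b (of_nat k - of_nat m) * v k - lam_ext n a b (of_nat k - of_nat m) * v k
          = G (Suc k) - G k" if k: "k < m" for k
  proof -
    define y :: complex where "y = of_nat k - of_nat m"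
    define X :: complex where "X = pochhammer (1 - of_nat m) k"
    define Z :: complex where "Z = pochhammer (- of_nat m) k"
    have y: "y \<noteq> 0" using k by (simp add: y_def)
    have m0: "(of_nat m :: complex) \<noteq> 0" using m by simp
    have Z: "Z \<noteq> 0" using k by (simp add: Z_def pochhammer_of_nat_eq_0_iff)
    have poch_Suc: "pochhammer (- of_nat m) (Suc k) = - of_nat m * X"
      unfolding X_def pochhammer_rec by simp
    have "pochhammer (- of_nat m) (Suc k) = y * Z"
      unfolding Z_def y_def pochhammer_rec' by simp
    then have XZ: "- of_nat m * X = y * Z" using poch_Suc by simp
    have X: "X \<noteq> 0" using XZ y Z m0 by auto
    have G_k: "G k = y * v k * cert n a b y"
    proof -
      have "- of_nat m * (P k / Z) = y * (P k / X)"
        unfolding times_divide_eq_right frac_eq_eq[OF Z X] using XZ by algebra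
      then show ?thesis unfolding G_def v_def X_def[symmetric] Z_def[symmetric] y_def[symmetric]
        by (simp only: mult.assoc)
    qed
    have "P (Suc k) = (a + y) * (b + y) * P k"
      unfolding P_def y_def pochhammer_rec' by (simp add: algebra_simps)
    moreover have "(of_nat (Suc k) - of_nat m :: complex) = y + 1" by (simp add: y_def)
    ultimately have "G (Suc k) = - of_nat m * ((a + y) * (b + y) * P k / (- of_nat m * X)) * cert n a b (y + 1)"
      unfolding G_def poch_Suc by presburger
    then have G_Suc: "G (Suc k) = (a + y) * (b + y) * v k * cert n a b (y + 1)"
      unfolding v_def X_def[symmetric] using m0 by simp
    show ?thesis
      unfolding G_Suc G_k y_def[symmetric] left_diff_distrib[symmetric] lam_ext_diff[OF a b]
      by algebra
  qed
  have "T (Suc n) - T n = (\<Sum>k<m. G (Suc k) - G k)"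
    unfolding T_def sum_subtractf[symmetric]
    using step by (intro sum.cong) (simp_all add: v_def P_def)
  also have "\<dots> = G m - G 0" by (rule sum_lessThan_telescope)
  also have "\<dots> = of_nat m * (cert n a b (- of_nat m) - (-1) ^ m / fact m * P m * cert n a b 0)"
  proof -
    have "1 / ((-1) ^ m * fact m) = ((-1) ^ m / fact m :: complex)"
      by (simp add: field_simps flip: power_mult_distrib)
    then have "P m / ((-1) ^ m * fact m) = (-1) ^ m / fact m * P m"
      by (metis mult.commute mult.right_neutral times_divide_eq_right)
    then show ?thesis
      unfolding G_def pochhammer_same by (simp add: P_def algebra_simps)
  qed
  finally show ?thesis by (simp only: P_def)
qed

section \<open>Negative integer parametric excess: the digamma series\<close>

text \<open>
  The digamma combination that multiplies the \<open>k\<close>-th term of the infinite series, where \<open>N\<close> stands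
  for \<open>n+a+b\<close>. It is minus the logarithmic derivative of
  \<open>\<Gamma>(a+x) \<Gamma>(b+x) / (\<Gamma>(N+x) \<Gamma>(1+x))\<close> at \<open>x = k\<close>.
\<close>
definition psi_comb :: "complex \<Rightarrow> complex \<Rightarrow> complex \<Rightarrow> nat \<Rightarrow> complex" where
  "psi_comb N a b k = Digamma (N + of_nat k) + Digamma (1 + of_nat k)
                        - Digamma (a + of_nat k) - Digamma (b + of_nat k)"

lemma psi_comb_Bseq:
  assumes "N \<notin> \<int>\<^sub>\<le>\<^sub>0" "a \<notin> \<int>\<^sub>\<le>\<^sub>0" "b \<notin> \<int>\<^sub>\<le>\<^sub>0"
  shows "Bseq (\<lambda>k. of_nat k * psi_comb N a b k)"
proof -
  obtain K where K: "\<And>k. norm (of_nat k * (Digamma (N + of_nat k) - Digamma (a + of_nat k))) \<le> K"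
    using Digamma_shift_diff_Bseq[OF assms(1,2)] unfolding Bseq_def by blast
  obtain L where L: "\<And>k. norm (of_nat k * (Digamma (1 + of_nat k) - Digamma (b + of_nat k))) \<le> L"
    using Digamma_shift_diff_Bseq[OF one_notin_nonpos_Ints assms(3)] unfolding Bseq_def by blast
  have "norm (of_nat k * psi_comb N a b k) \<le> K + L" for k
  proof -
    have "of_nat k * psi_comb N a b k
            = of_nat k * (Digamma (N + of_nat k) - Digamma (a + of_nat k))
              + of_nat k * (Digamma (1 + of_nat k) - Digamma (b + of_nat k))"
      by (simp add: psi_comb_def algebra_simps)
    then show ?thesis using norm_triangle_mono[OF K L] by presburger
  qed
  then show ?thesis by (rule BseqI')
qed

lemma psi_comb_Suc:
  assumes "N \<notin> \<int>\<^sub>\<le>\<^sub>0" "a \<notin> \<int>\<^sub>\<le>\<^sub>0" "b \<notin> \<int>\<^sub>\<le>\<^sub>0"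
  shows "psi_comb N a b (Suc k) = psi_comb N a b k + 1 / (N + of_nat k) + 1 / (1 + of_nat k)
           - 1 / (a + of_nat k) - 1 / (b + of_nat k)"
proof -
  have "Digamma (u + of_nat (Suc k)) = Digamma (u + of_nat k) + 1 / (u + of_nat k)"
    if "u \<notin> \<int>\<^sub>\<le>\<^sub>0" for u :: complex
    using Digamma_plus1[OF not_nonpos_Int_add_of_nat(2)[OF that, of k]] by (simp add: add_ac)
  from this[OF assms(1)] this[OF assms(2)] this[OF assms(3)] this[of 1] show ?thesis
    by (simp add: psi_comb_def)
qed

lemma psi_comb_plus1:
  assumes "N \<notin> \<int>\<^sub>\<le>\<^sub>0"
  shows "psi_comb (N + 1) a b k = psi_comb N a b k + 1 / (N + of_nat k)"
  using Digamma_plus1[OF not_nonpos_Int_add_of_nat(2)[OF assms, of k]]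
  by (simp add: psi_comb_def add_ac)

lemma summable_mult_of_Bseq:
  fixes r e :: "nat \<Rightarrow> complex"
  assumes "Bseq (\<lambda>k. of_nat k * r k)" "Bseq (\<lambda>k. of_nat k * e k)"
  shows "summable (\<lambda>k. r k * e k)"
proof -
  obtain K where K: "\<And>k. norm (of_nat k * r k) \<le> K" using assms(1) unfolding Bseq_def by blast
  obtain L where L: "\<And>k. norm (of_nat k * e k) \<le> L" using assms(2) unfolding Bseq_def by blast
  have "summable (\<lambda>k. K * L * inverse (real k ^ 2))"
    by (intro summable_mult inverse_power_summable) simp
  moreover have "norm (r k * e k) \<le> K * L * inverse (real k ^ 2)" if "k \<ge> 1" for k
  proof -
    have "norm (of_nat k * r k) * norm (of_nat k * e k) \<le> K * L"
      using K L by (meson mult_mono norm_ge_zero order_trans)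
    then show ?thesis using that by (simp add: norm_mult field_simps power2_eq_square)
  qed
  ultimately show ?thesis by (rule summable_comparison_test'[where N = 1])
qed

lemma lam_ext_of_nat:
  assumes "of_nat n + a + b \<notin> \<int>\<^sub>\<le>\<^sub>0"
  shows "lam_ext n a b (of_nat k) = lam n a b / pochhammer (of_nat n + a + b) k"
proof -
  have "pochhammer (of_nat n + a + b) k \<noteq> 0" using assms pochhammer_eq_0_imp_nonpos_Int by blast
  then have "rGamma (of_nat n + a + b + of_nat k) = rGamma (of_nat n + a + b) / pochhammer (of_nat n + a + b) k"
    using pochhammer_rGamma[of "of_nat n + a + b" k] by simp
  then show ?thesis
    by (simp add: lam_ext_def lam_def rGamma_inverse_Gamma[of "of_nat n"]
        rGamma_inverse_Gamma[of "of_nat n + a + b"] divide_inverse)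
qed

text \<open>
  The algebraic core of the telescoping of the digamma series, to be read with \<open>x = k\<close>, with \<open>e\<close> the
  digamma combination and \<open>v\<close> the weight at \<open>k\<close>, with \<open>R = cert(k+1)\<close>, and with \<open>p, q, r, t\<close> the
  reciprocals that appear when \<open>k\<close> or \<open>n\<close> is increased by one in the digamma combination.
\<close>
lemma log_certificate_identity:
  fixes a b n x p q r t e v R :: complex
  assumes p: "(a + x) * p = 1" and q: "(b + x) * q = 1"
    and r: "(n + a + b + x) * r = 1" and t: "(1 + x) * t = 1"
  shows "(n + a) * (n + b) * R * (v * (e + r)) - n * ((n + a + b + x) * R) * (v * e)
           = ((1 + x) * (e + r + t - p - q) - 1) * ((a + x) * (b + x) * v * t * R)
               - (x * e - 1) * (v * ((n + a + b + x) * R))"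
proof -
  define s where "s = e + r - p - q"
  have "(1 + x) * (e + r + t - p - q) - 1 = (1 + x) * s"
    using t by (simp add: s_def algebra_simps)
  then have "((1 + x) * (e + r + t - p - q) - 1) * ((a + x) * (b + x) * v * t * R)
               = ((1 + x) * t) * (s * ((a + x) * (b + x)) * v * R)"
    by (simp only: mult_ac)
  also have "\<dots> = s * ((a + x) * (b + x)) * v * R" by (simp only: t mult_1)
  also have "s * ((a + x) * (b + x))
               = e * ((a + x) * (b + x)) + r * ((a + x) * (b + x))
                   - (b + x) * ((a + x) * p) - (a + x) * ((b + x) * q)"
    unfolding s_def by (simp only: algebra_simps)
  also have "\<dots> = e * ((a + x) * (b + x)) + r * ((a + x) * (b + x)) - (b + x) - (a + x)"
    unfolding p q by simp
  also have "r * ((a + x) * (b + x)) = (n + a) * (n + b) * r - (n - x) * ((n + a + b + x) * r)"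
    by (simp add: algebra_simps)
  also have "\<dots> = (n + a) * (n + b) * r - (n - x)"
    unfolding r by simp
  finally show ?thesis
    by (simp add: algebra_simps)
qed

text \<open>
  With the weight \<open>v(x) = \<Gamma>(a+x) \<Gamma>(b+x) / \<Gamma>(1+x)\<close> the telescoping identity holds as an
  identity of meromorphic functions of \<open>x\<close>; the relation below is minus its derivative in \<open>x\<close> (divided by \<open>\<Gamma>(a) \<Gamma>(b)\<close>), summed over
  \<open>x = 0, 1, 2, \<dots>\<close>.
\<close>
lemma log_part_sums:
  fixes a b :: complex
  defines "v \<equiv> \<lambda>k. pochhammer a k * pochhammer b k / fact k"
  defines "E \<equiv> \<lambda>n. psi_comb (of_nat n + a + b) a b"
  assumes a: "a \<notin> \<int>\<^sub>\<le>\<^sub>0" and b: "b \<notin> \<int>\<^sub>\<le>\<^sub>0" and N: "of_nat n + a + b \<notin> \<int>\<^sub>\<le>\<^sub>0"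
  shows "(\<lambda>k. lam_ext (Suc n) a b (of_nat k) * (v k * E (Suc n) k)
              - lam_ext n a b (of_nat k) * (v k * E n k)) sums cert n a b 0"
proof -
  let ?N = "of_nat n + a + b"
  \<comment> \<open>Up to a constant factor this is minus the derivative of \<open>x v(x) cert(x)\<close> at \<open>x = k\<close>; the term
    \<open>-1\<close> comes from the factor \<open>x\<close>.\<close>
  define G where "G k = (of_nat k * E n k - 1) * (v k * cert n a b (of_nat k))" for k
  have diff: "lam_ext (Suc n) a b (of_nat k) * (v k * E (Suc n) k)
                - lam_ext n a b (of_nat k) * (v k * E n k) = G (Suc k) - G k" for k
  proof -
    define x :: complex where "x = of_nat k"
    define R where "R = cert n a b (x + 1)"
    note nz = not_nonpos_Int_add_of_nat(2)[OF a, of k, folded x_def]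
      not_nonpos_Int_add_of_nat(2)[OF b, of k, folded x_def]
      not_nonpos_Int_add_of_nat(2)[OF N, of k, folded x_def]
    have x1: "1 + x \<noteq> 0" unfolding x_def by (metis of_nat_Suc of_nat_eq_0_iff nat.distinct(1))
    have "of_nat (Suc n) + a + b = ?N + 1" by simp
    then have E1: "E (Suc n) k = E n k + 1 / (?N + x)"
      unfolding E_def x_def using psi_comb_plus1[OF N] by presburger
    have E2: "E n (Suc k) = E n k + 1 / (?N + x) + 1 / (1 + x) - 1 / (a + x) - 1 / (b + x)"
      unfolding E_def x_def by (rule psi_comb_Suc[OF N a b])
    have v_Suc: "v (Suc k) = (a + x) * (b + x) * v k / (1 + x)"
      using x1 unfolding v_def x_def fact_Suc pochhammer_Suc by (simp add: divide_simps)
    have "of_nat (Suc k) = 1 + x" "1 + x = x + 1" by (simp_all add: x_def)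
    then have G_Suc: "G (Suc k) = ((1 + x) * E n (Suc k) - 1) * (v (Suc k) * R)"
      unfolding G_def R_def by presburger
    have G_k: "G k = (x * E n k - 1) * (v k * ((?N + x) * R))"
      unfolding G_def R_def x_def by (simp only: cert_plus1[of n a b "of_nat k"])
    have lams: "lam_ext (Suc n) a b x = (of_nat n + a) * (of_nat n + b) * R"
               "lam_ext n a b x = of_nat n * ((?N + x) * R)"
      unfolding R_def lam_ext_Suc[OF a b] lam_ext_eq_cert[of n] cert_plus1[of n a b x] by simp_all
    define p where "p = 1 / (a + x)"
    define q where "q = 1 / (b + x)"
    define r where "r = 1 / (?N + x)"
    define t where "t = 1 / (1 + x)"
    have inv: "(a + x) * p = 1" "(b + x) * q = 1" "(?N + x) * r = 1" "(1 + x) * t = 1"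
      unfolding p_def q_def r_def t_def using nz x1 by simp_all
    have v_Suc': "v (Suc k) = (a + x) * (b + x) * v k * t" by (simp add: v_Suc t_def)
    show ?thesis
      unfolding x_def[symmetric] lams G_k G_Suc E1 E2 v_Suc'
      unfolding p_def[symmetric] q_def[symmetric] r_def[symmetric] t_def[symmetric]
      by (rule log_certificate_identity[OF inv])
  qed
  define \<rho> where "\<rho> k = pochhammer a k * pochhammer b k / (pochhammer ?N k * fact k)" for k
  define C where "C = cert n a b 0"
  have G_eq: "G k = C * ((of_nat k * \<rho> k) * E n k - \<rho> k)" for k
  proof -
    have "pochhammer ?N k \<noteq> 0" using N pochhammer_eq_0_imp_nonpos_Int by blast
    then have "cert n a b (of_nat k) = C / pochhammer ?N k"
      using pochhammer_rGamma[of ?N k] by (simp add: C_def cert_def)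
    moreover have "\<rho> k = v k / pochhammer ?N k"
      by (simp add: \<rho>_def v_def)
    ultimately show ?thesis
      unfolding G_def by (simp add: left_diff_distrib right_diff_distrib diff_divide_distrib mult_ac)
  qed
  have \<rho>: "Bseq (\<lambda>k. of_nat k * \<rho> k)"
    unfolding \<rho>_def by (rule pochhammer_quotient_Bseq[OF N])
  have to_0: "u \<longlonglongrightarrow> 0" if "Bseq (\<lambda>k. of_nat k * u k)" for u :: "nat \<Rightarrow> complex"
  proof -
    have "(\<lambda>k. inverse (of_nat k) * (of_nat k * u k)) \<longlonglongrightarrow> 0"
      using bounded_bilinear.Zfun_prod_Bfun[OF bounded_bilinear_mult _ that,
          of "\<lambda>k. inverse (of_nat k)"] lim_inverse_n[where 'a = complex]
      by (simp only: tendsto_Zfun_iff diff_zero)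
    then show ?thesis
      by (rule Lim_transform_eventually)
         (use eventually_gt_at_top[of "0::nat"] in eventually_elim, simp)
  qed
  have "(\<lambda>k. of_nat k * \<rho> k * E n k) \<longlonglongrightarrow> 0"
  proof (rule to_0)
    have "Bseq (\<lambda>k. (of_nat k * \<rho> k) * (of_nat k * E n k))"
      unfolding E_def by (intro Bseq_mult \<rho> psi_comb_Bseq N a b)
    then show "Bseq (\<lambda>k. of_nat k * (of_nat k * \<rho> k * E n k))"
      by (simp only: mult_ac)
  qed
  then have "G \<longlonglongrightarrow> C * (0 - 0)"
    unfolding G_eq[abs_def] by (intro tendsto_intros to_0[OF \<rho>])
  then have "(\<lambda>k. G (Suc k) - G k) sums (C * (0 - 0) - G 0)"
    by (rule telescope_sums)
  then show ?thesis
    unfolding diff by (simp add: G_def C_def v_def)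
qed

lemma summable_psi_series:
  assumes "of_nat n + a + b \<notin> \<int>\<^sub>\<le>\<^sub>0" "a \<notin> \<int>\<^sub>\<le>\<^sub>0" "b \<notin> \<int>\<^sub>\<le>\<^sub>0"
  shows "summable (\<lambda>k. pochhammer a k * pochhammer b k / (pochhammer (of_nat n + a + b) k * fact k)
                        * psi_comb (of_nat n + a + b) a b k)"
  by (intro summable_mult_of_Bseq pochhammer_quotient_Bseq psi_comb_Bseq assms)

text \<open>
  The induction starts at \<open>n = 0\<close>, where both sides vanish because \<open>1/\<Gamma>(0) = 0\<close>. The series converges
  for \<open>n = 0\<close> too, so that its increment from \<open>n = 0\<close> to \<open>n = 1\<close> is covered by
  the telescoping as well.
\<close>
lemma hyp_partial_sum_excess_neg:
  fixes a b c :: complex and m :: nat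
  defines "F \<equiv> \<lambda>n. \<Sum>k<m. lam_ext n a b (of_nat k - of_nat m)
            * (pochhammer (a - of_nat m) k * pochhammer (b - of_nat m) k / pochhammer (1 - of_nat m) k)"
  defines "L \<equiv> \<lambda>n. lam n a b * (\<Sum>k. pochhammer a k * pochhammer b k
            / (pochhammer (of_nat n + a + b) k * fact k) * psi_comb (of_nat n + a + b) a b k)"
  assumes a: "a - of_nat m \<notin> \<int>\<^sub>\<le>\<^sub>0" and b: "b - of_nat m \<notin> \<int>\<^sub>\<le>\<^sub>0"
    and c: "c \<notin> \<int>\<^sub>\<le>\<^sub>0" and m: "m > 0" and s: "c = a + b - of_nat m"
  shows "hyp_partial_sum n a b c =
           Gamma c / (of_nat m * Gamma a * Gamma b) * F n
             + (-1) ^ m / fact m * Gamma c / (Gamma (a - of_nat m) * Gamma (b - of_nat m)) * L n"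
proof (induction n)
  case 0
  show ?case by (simp add: hyp_partial_sum_def F_def L_def lam_def)
next
  case (Suc n)
  have a': "a \<notin> \<int>\<^sub>\<le>\<^sub>0" using not_nonpos_Int_add_of_nat(1)[OF a, of m] by simp
  have b': "b \<notin> \<int>\<^sub>\<le>\<^sub>0" using not_nonpos_Int_add_of_nat(1)[OF b, of m] by simp
  have N: "of_nat i + a + b \<notin> \<int>\<^sub>\<le>\<^sub>0" for i
    using not_nonpos_Int_add_of_nat(1)[OF c, of "i + m"] by (simp add: s algebra_simps)
  have L_sums: "(\<lambda>k. lam_ext i a b (of_nat k) * (pochhammer a k * pochhammer b k / fact k
                   * psi_comb (of_nat i + a + b) a b k)) sums L i" for i
  proof -
    have "lam_ext i a b (of_nat k) * (pochhammer a k * pochhammer b k / fact k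
            * psi_comb (of_nat i + a + b) a b k)
          = lam i a b * (pochhammer a k * pochhammer b k / (pochhammer (of_nat i + a + b) k * fact k)
            * psi_comb (of_nat i + a + b) a b k)" for k
      unfolding lam_ext_of_nat[OF N] by (simp add: field_simps)
    then show ?thesis
      unfolding L_def using summable_psi_series[OF N a' b', of i]
      by (simp only: sums_mult summable_sums)
  qed
  have L_Suc: "L (Suc n) = L n + cert n a b 0"
    using sums_unique2[OF sums_diff[OF L_sums[of "Suc n"] L_sums[of n]] log_part_sums[OF a' b' N]]
    by (simp add: algebra_simps)
  have F_Suc: "F (Suc n) = F n + of_nat m * (cert n a b (- of_nat m)
           - (-1) ^ m / fact m * (pochhammer (a - of_nat m) m * pochhammer (b - of_nat m) m)
               * cert n a b 0)"
    using finite_part_diff[OF a' b' m, of n] unfolding F_def by (simp add: algebra_simps)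
  have poch: "pochhammer (a - of_nat m) m = Gamma a / Gamma (a - of_nat m)"
             "pochhammer (b - of_nat m) m = Gamma b / Gamma (b - of_nat m)"
    using pochhammer_Gamma[OF a, of m] pochhammer_Gamma[OF b, of m] by simp_all
  have nz: "Gamma a \<noteq> 0" "Gamma b \<noteq> 0" "(of_nat m :: complex) \<noteq> 0"
    using a' b' m by (simp_all add: Gamma_eq_zero_iff)
  have "c - a - b = - of_nat m" by (simp add: s)
  then have "hyp_partial_sum (Suc n) a b c
      = hyp_partial_sum n a b c + Gamma c / (Gamma a * Gamma b) * cert n a b (- of_nat m)"
    using hyp_partial_sum_Suc[OF a' b' c, of n] by simp
  also have "\<dots> = Gamma c / (of_nat m * Gamma a * Gamma b) * F (Suc n)
      + (-1) ^ m / fact m * Gamma c / (Gamma (a - of_nat m) * Gamma (b - of_nat m)) * L (Suc n)"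
    unfolding Suc.IH F_Suc L_Suc poch using nz by (simp add: ring_distribs)
  finally show ?case .
qed

section \<open>The two closed forms\<close>

lemma lam_quot_eq_lam_ext: "lam_quot n a b k = lam_ext n a b (of_nat k)"
proof (cases "of_nat n + a + b \<in> \<int>\<^sub>\<le>\<^sub>0")
  case True
  then show ?thesis
    by (simp add: lam_quot_def lam_ext_def rGamma_inverse_Gamma[of "of_nat n"] divide_inverse)
next
  case False
  then show ?thesis by (simp add: lam_quot_def lam_ext_of_nat)
qed

lemma diff_of_nat_not_nonpos_Int:
  fixes z :: complex
  assumes "z \<notin> \<int>\<^sub>\<le>\<^sub>0" "z \<notin> of_nat ` {1..m}"
  shows "z - of_nat m \<notin> \<int>\<^sub>\<le>\<^sub>0"
proof
  assume "z - of_nat m \<in> \<int>\<^sub>\<le>\<^sub>0"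
  then obtain j where "z - of_nat m = - of_nat j" by (auto elim: nonpos_Ints_cases')
  then have z: "z = of_nat m - of_nat j" by (simp add: algebra_simps)
  show False
  proof (cases "j < m")
    case True
    then have "z = of_nat (m - j)" using z by (simp add: of_nat_diff)
    moreover have "m - j \<in> {1..m}" using True by auto
    ultimately show False using assms(2) by blast
  next
    case False
    then have "z = - of_nat (j - m)" using z by (simp add: of_nat_diff)
    then show False using assms(1) by simp
  qed
qed

theorem theorem2:
  fixes m n :: nat and a b c s :: complex
  assumes "m > 0" and "n > 0"
    and "a \<notin> \<int>\<^sub>\<le>\<^sub>0" and "b \<notin> \<int>\<^sub>\<le>\<^sub>0" and "c \<notin> \<int>\<^sub>\<le>\<^sub>0"
    and "s = c - a - b"
  defines "f \<equiv> \<lambda>k. pochhammer a k * pochhammer b k / (pochhammer (of_nat n + a + b) k * fact k)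
                  * (Digamma (of_nat n + a + b + of_nat k) + Digamma (1 + of_nat k)
                     - Digamma (a + of_nat k) - Digamma (b + of_nat k))"
  shows "(s = of_nat m \<longrightarrow>
            hyp_partial_sum n a b c =
              Gamma c * Gamma (c - a - b) / (Gamma (c - a) * Gamma (c - b))
                * (\<Sum>k<m. lam_quot n a b k * (pochhammer a k * pochhammer b k / fact k)))
       \<and> (s = - of_nat m \<and> a \<notin> of_nat ` {1..m} \<and> b \<notin> of_nat ` {1..m} \<longrightarrow>
            summable f \<and>
            hyp_partial_sum n a b c =
              omega n a b c * Gamma c / (of_nat m * Gamma a * Gamma b)
                * (\<Sum>k<m. pochhammer (c - a) k * pochhammer (c - b) k
                           / (pochhammer (of_nat n + c) k * pochhammer (1 - of_nat m) k))
              + (-1) ^ m / fact m * (lam n a b * Gamma c / (Gamma (c - a) * Gamma (c - b)))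
                * (\<Sum>k. f k))"
proof (intro conjI impI; (elim conjE)?)
  assume "s = of_nat m"
  then have "c = a + b + of_nat m" "c - a - b = of_nat m" using assms(6) by (auto simp: algebra_simps)
  then show "hyp_partial_sum n a b c =
              Gamma c * Gamma (c - a - b) / (Gamma (c - a) * Gamma (c - b))
                * (\<Sum>k<m. lam_quot n a b k * (pochhammer a k * pochhammer b k / fact k))"
    using hyp_partial_sum_excess_pos[OF assms(3-5,1)] by (simp add: lam_quot_eq_lam_ext)
next
  assume s: "s = - of_nat m" and "a \<notin> of_nat ` {1..m}" "b \<notin> of_nat ` {1..m}"
  then have am: "a - of_nat m \<notin> \<int>\<^sub>\<le>\<^sub>0" and bm: "b - of_nat m \<notin> \<int>\<^sub>\<le>\<^sub>0"
    by (simp_all only: diff_of_nat_not_nonpos_Int assms(3,4) not_False_eq_True)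
  have c: "c = a + b - of_nat m" and cab: "c - a = b - of_nat m" "c - b = a - of_nat m"
    using s assms(6) by (auto simp: algebra_simps)
  have N: "of_nat n + a + b \<notin> \<int>\<^sub>\<le>\<^sub>0"
    using not_nonpos_Int_add_of_nat(1)[OF assms(5), of "n + m"] by (simp add: c algebra_simps)
  have f: "f = (\<lambda>k. pochhammer a k * pochhammer b k / (pochhammer (of_nat n + a + b) k * fact k)
                    * psi_comb (of_nat n + a + b) a b k)"
    by (simp add: f_def psi_comb_def)
  show "summable f"
    unfolding f by (rule summable_psi_series[OF N assms(3,4)])
  have shifted: "lam_ext n a b (of_nat k - of_nat m) = omega n a b c / pochhammer (of_nat n + c) k" for k
  proof -
    have "of_nat n + c \<notin> \<int>\<^sub>\<le>\<^sub>0"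
      using not_nonpos_Int_add_of_nat(1)[OF assms(5), of n] by (simp add: add.commute)
    then have "pochhammer (of_nat n + c) k \<noteq> 0"
      using pochhammer_eq_0_imp_nonpos_Int by blast
    then have rG: "rGamma (of_nat n + c + of_nat k) = rGamma (of_nat n + c) / pochhammer (of_nat n + c) k"
      using pochhammer_rGamma[of "of_nat n + c" k] by simp
    have arg: "of_nat n + a + b + (of_nat k - of_nat m) = of_nat n + c + of_nat k"
      by (simp add: c)
    show ?thesis
      unfolding lam_ext_def arg rG
      by (simp add: omega_def rGamma_inverse_Gamma divide_inverse)
  qed
  have "(\<Sum>k<m. lam_ext n a b (of_nat k - of_nat m)
            * (pochhammer (a - of_nat m) k * pochhammer (b - of_nat m) k / pochhammer (1 - of_nat m) k))
        = omega n a b c * (\<Sum>k<m. pochhammer (c - a) k * pochhammer (c - b) k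
                           / (pochhammer (of_nat n + c) k * pochhammer (1 - of_nat m) k))"
    unfolding shifted cab sum_distrib_left by (simp add: mult_ac)
  then show "hyp_partial_sum n a b c =
              omega n a b c * Gamma c / (of_nat m * Gamma a * Gamma b)
                * (\<Sum>k<m. pochhammer (c - a) k * pochhammer (c - b) k
                           / (pochhammer (of_nat n + c) k * pochhammer (1 - of_nat m) k))
              + (-1) ^ m / fact m * (lam n a b * Gamma c / (Gamma (c - a) * Gamma (c - b)))
                * (\<Sum>k. f k)"
    unfolding hyp_partial_sum_excess_neg[OF am bm assms(5,1) c] f cab by (simp add: mult_ac)
qed

end
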